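(* Let $(\mathcal{F}=\mathcal{F}^{+}\dot{+}\mathcal{F}^{-},[\cdot,\cdot],\mathcal{J})$ be a Krein space with the associated two-inner product $$\psi(x,y,z)=[x^{+},y^{+}]\,\|z^{+}\|_{+}^{2}+[x^{-},y^{-}]\,\|z^{-}\|_{-}^{2}.$$ Then the fundamental symmetry $\mathcal{J}$ has the following properties: (1) $\mathcal{J}$ is two-symmetric and two-self-adjoint, i.e. $\psi(\mathcal{J}x,y,z)=\psi(x,\mathcal{J}y,z)$ for all $x,y,z\in\mathcal{F}$; (2) $\mathcal{J}$ is two-isometric, i.e. $\psi(\mathcal{J}x,\mathcal{J}y,z)=\psi(x,y,z)$ for all $x,y,z\in\mathcal{F}$; (3) $\mathcal{J}$ is two-bounded, i.e. there is a constant $K>0$ such that $\mathcal{N}(\mathcal{J}x,t)+\mathcal{N}(x,\mathcal{J}t)\le K\,\mathcal{N}(x,t)$ for all $x,t\in\mathcal{F}$, where $\mathcal{N}(x,t)=\sqrt{\psi(x,x,t)}$.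
   Context: A Krein space is a pair $(\mathcal{F},[\cdot,\cdot])$ where $\mathcal{F}$ is a complex vector space and $[\cdot,\cdot]$ is an indefinite inner product (a Hermitian sesquilinear form, linear in the first variable) admitting a direct sum decomposition $\mathcal{F}=\mathcal{F}^{+}\dot{+}\mathcal{F}^{-}$ into mutually $[\cdot,\cdot]$-orthogonal subspaces (a fundamental decomposition) such that $(\mathcal{F}^{+},[\cdot,\cdot])$ and $(\mathcal{F}^{-},-[\cdot,\cdot])$ are Hilbert spaces. Each $x\in\mathcal{F}$ is written $x=x^{+}+x^{-}$ with $x^{\pm}\in\mathcal{F}^{\pm}$. The fundamental symmetry is $\mathcal{J}x=x^{+}-x^{-}$. The norms on $\mathcal{F}^{\pm}$ are $\|x^{+}\|_{+}=\sqrt{[x^{+},x^{+}]}$ and $\|x^{-}\|_{-}=\sqrt{-[x^{-},x^{-}]}$. *)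

theory Defs
  imports "HOL-Analysis.Analysis" "HOL-Library.Complex_Order"
begin

text \<open>
  A Hermitian sesquilinear form, linear in the first variable, on the complex vector space given by
  the whole type \<open>'a\<close> with scalar multiplication \<open>cscale\<close>. As usual, ``indefinite'' only means that no
  definiteness is required.
\<close>

locale indefinite_inner_product = vector_space cscale
  for cscale :: "complex \<Rightarrow> 'a::ab_group_add \<Rightarrow> 'a" +
  fixes ip :: "'a \<Rightarrow> 'a \<Rightarrow> complex"
  assumes ip_add_left: "ip (x + y) z = ip x z + ip y z"
    and ip_scale_left: "ip (cscale c x) z = c * ip x z"
    and ip_hermitian: "ip x y = cnj (ip y x)"

definition form_norm :: "('a \<Rightarrow> 'a \<Rightarrow> complex) \<Rightarrow> 'a \<Rightarrow> real" where
  "form_norm f x = sqrt (Re (f x x))"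

text \<open>
  \<open>(S, f)\<close> is a Hilbert space, for a subspace \<open>S\<close> and a form \<open>f\<close> already known to be Hermitian and
  sesquilinear. In \<open>0 < f x x\<close> the order is that of \<open>Complex_Order\<close>, where \<open>0 < z\<close> says that \<open>z\<close> is
  real and positive.
\<close>

definition is_hilbert ::
    "(complex \<Rightarrow> 'a::ab_group_add \<Rightarrow> 'a) \<Rightarrow> 'a set \<Rightarrow> ('a \<Rightarrow> 'a \<Rightarrow> complex) \<Rightarrow> bool" where
  "is_hilbert cscale S f \<longleftrightarrow>
     module.subspace cscale S \<and>
     (\<forall>x\<in>S. x \<noteq> 0 \<longrightarrow> 0 < f x x) \<and>
     (\<forall>X :: nat \<Rightarrow> 'a.
        (\<forall>n. X n \<in> S) \<and> (\<forall>e>0. \<exists>M. \<forall>m\<ge>M. \<forall>n\<ge>M. form_norm f (X m - X n) < e) \<longrightarrow>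
        (\<exists>x\<in>S. (\<lambda>n. form_norm f (X n - x)) \<longlonglongrightarrow> 0))"

text \<open>A Krein space together with a chosen fundamental decomposition \<open>Fp\<close>, \<open>Fm\<close>.\<close>

locale krein_space = indefinite_inner_product cscale ip
  for cscale :: "complex \<Rightarrow> 'a::ab_group_add \<Rightarrow> 'a" and ip :: "'a \<Rightarrow> 'a \<Rightarrow> complex" +
  fixes Fp Fm :: "'a set"
  assumes hilbert_plus: "is_hilbert cscale Fp ip"
    and hilbert_minus: "is_hilbert cscale Fm (\<lambda>x y. - ip x y)"
    and decomp_ex: "\<exists>p\<in>Fp. \<exists>m\<in>Fm. x = p + m"
    and decomp_direct: "Fp \<inter> Fm = {0}"
    and orthogonal: "\<lbrakk>p \<in> Fp; m \<in> Fm\<rbrakk> \<Longrightarrow> ip p m = 0"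

text \<open>The components \<open>x\<^sup>+\<close> and \<open>x\<^sup>-\<close> of \<open>x\<close>; they are determined by the direct sum.\<close>

definition plus_part :: "'a::ab_group_add set \<Rightarrow> 'a set \<Rightarrow> 'a \<Rightarrow> 'a" where
  "plus_part Fp Fm x = (THE p. p \<in> Fp \<and> (\<exists>m\<in>Fm. x = p + m))"

definition minus_part :: "'a::ab_group_add set \<Rightarrow> 'a set \<Rightarrow> 'a \<Rightarrow> 'a" where
  "minus_part Fp Fm x = (THE m. m \<in> Fm \<and> (\<exists>p\<in>Fp. x = p + m))"

definition fundamental_symmetry :: "'a::ab_group_add set \<Rightarrow> 'a set \<Rightarrow> 'a \<Rightarrow> 'a" where
  "fundamental_symmetry Fp Fm x = plus_part Fp Fm x - minus_part Fp Fm x"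

definition two_inner ::
    "('a::ab_group_add \<Rightarrow> 'a \<Rightarrow> complex) \<Rightarrow> 'a set \<Rightarrow> 'a set \<Rightarrow> 'a \<Rightarrow> 'a \<Rightarrow> 'a \<Rightarrow> complex" where
  "two_inner ip Fp Fm x y z =
     ip (plus_part Fp Fm x) (plus_part Fp Fm y)
       * of_real ((form_norm ip (plus_part Fp Fm z))\<^sup>2)
     + ip (minus_part Fp Fm x) (minus_part Fp Fm y)
       * of_real ((form_norm (\<lambda>u v. - ip u v) (minus_part Fp Fm z))\<^sup>2)"

text \<open>
  The form \<open>[\<cdot>,\<cdot>]\<close> is negative definite on \<open>Fm\<close>, so the real number \<open>two_inner ip Fp Fm x x t\<close> can be
  negative. The square root is therefore the complex principal one, which is the usual real root for
  nonnegative arguments and purely imaginary for negative ones. An inequality between such roots is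
  read in the order of \<open>Complex_Order\<close> (\<open>z \<le> w\<close> iff \<open>w - z\<close> is real and nonnegative); it is the
  ordinary real inequality as soon as the roots are real.
\<close>

definition two_norm ::
    "('a::ab_group_add \<Rightarrow> 'a \<Rightarrow> complex) \<Rightarrow> 'a set \<Rightarrow> 'a set \<Rightarrow> 'a \<Rightarrow> 'a \<Rightarrow> complex" where
  "two_norm ip Fp Fm x t = csqrt (two_inner ip Fp Fm x x t)"

end

theory Submission
  imports Defs
begin

text \<open>
  In the decomposition \<open>x = p + m\<close> the fundamental symmetry changes only the sign of the negative
  component: \<open>Jx\<close> has components \<open>p\<close> and \<open>-m\<close> (lemmas \<open>plus_part_symmetry\<close> and
  \<open>minus_part_symmetry\<close>). The two-inner product sees the negative components of its first two
  arguments only through a sesquilinear form. Hence a sign can be moved from one of them to the other,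
  and two signs cancel. Its third argument enters only through norms, which ignore signs, so
  \<open>\<psi> x y (Jz) = \<psi> x y z\<close>. Consequently \<open>\<N>(Jx, t) = \<N>(x, Jt) = \<N>(x, t)\<close>, and the constant
  \<open>2\<close> gives equality in the boundedness estimate. Being an equality,
  it holds also where \<open>\<psi> x x t\<close> is negative and \<open>\<N>(x, t)\<close> therefore imaginary.
\<close>

context krein_space
begin

lemma subspace_plus: "subspace Fp" and subspace_minus: "subspace Fm"
  using hilbert_plus hilbert_minus by (auto simp: is_hilbert_def)

lemma components_unique:
  assumes "p \<in> Fp" "m \<in> Fm" "q \<in> Fp" "n \<in> Fm" "p + m = q + n"
  shows "p = q" "m = n"
proof -
  \<comment> \<open>The same vector, seen from the two sides, lies in both summands.\<close>
  have eq: "p - q = n - m" using assms(5) by (simp add: algebra_simps)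
  have "p - q \<in> Fp" using assms subspace_diff[OF subspace_plus] by blast
  moreover have "n - m \<in> Fm" using assms subspace_diff[OF subspace_minus] by blast
  ultimately have "p - q \<in> Fp \<inter> Fm" using eq by simp
  then have "p - q = 0" using decomp_direct by simp
  then show "p = q" "m = n" using eq by simp_all
qed

lemma plus_part_add [simp]: "p \<in> Fp \<Longrightarrow> m \<in> Fm \<Longrightarrow> plus_part Fp Fm (p + m) = p"
  unfolding plus_part_def by (rule the_equality) (blast dest: components_unique)+

lemma minus_part_add [simp]: "p \<in> Fp \<Longrightarrow> m \<in> Fm \<Longrightarrow> minus_part Fp Fm (p + m) = m"
  unfolding minus_part_def by (rule the_equality) (blast dest: components_unique)+

lemma symmetry_add:
  assumes "p \<in> Fp" "m \<in> Fm"
  shows "fundamental_symmetry Fp Fm (p + m) = p + (- m)"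
  using assms by (simp add: fundamental_symmetry_def)

lemma plus_part_symmetry:
  "plus_part Fp Fm (fundamental_symmetry Fp Fm x) = plus_part Fp Fm x"
proof -
  obtain p m where "p \<in> Fp" "m \<in> Fm" "x = p + m" using decomp_ex by blast
  then show ?thesis
    by (simp add: symmetry_add subspace_neg[OF subspace_minus] del: add_uminus_conv_diff)
qed

lemma minus_part_symmetry:
  "minus_part Fp Fm (fundamental_symmetry Fp Fm x) = - minus_part Fp Fm x"
proof -
  obtain p m where "p \<in> Fp" "m \<in> Fm" "x = p + m" using decomp_ex by blast
  then show ?thesis
    by (simp add: symmetry_add subspace_neg[OF subspace_minus] del: add_uminus_conv_diff)
qed

lemma ip_minus_left: "ip (- x) y = - ip x y"
  using ip_scale_left[of "-1" x y] by simp

lemma ip_minus_right: "ip x (- y) = - ip x y"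
  by (metis ip_hermitian ip_minus_left complex_cnj_minus)

lemma two_inner_symmetry_left:
  "two_inner ip Fp Fm (fundamental_symmetry Fp Fm x) y z
    = two_inner ip Fp Fm x (fundamental_symmetry Fp Fm y) z"
  by (simp add: two_inner_def plus_part_symmetry minus_part_symmetry ip_minus_left ip_minus_right)

lemma two_inner_symmetry_both:
  "two_inner ip Fp Fm (fundamental_symmetry Fp Fm x) (fundamental_symmetry Fp Fm y) z
    = two_inner ip Fp Fm x y z"
  by (simp add: two_inner_def plus_part_symmetry minus_part_symmetry ip_minus_left ip_minus_right)

lemma two_inner_symmetry_third:
  "two_inner ip Fp Fm x y (fundamental_symmetry Fp Fm z) = two_inner ip Fp Fm x y z"
  by (simp add: two_inner_def form_norm_def plus_part_symmetry minus_part_symmetry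
      ip_minus_left ip_minus_right)

lemma two_norm_symmetry:
  "two_norm ip Fp Fm (fundamental_symmetry Fp Fm x) t = two_norm ip Fp Fm x t"
  "two_norm ip Fp Fm x (fundamental_symmetry Fp Fm t) = two_norm ip Fp Fm x t"
  by (simp_all add: two_norm_def two_inner_symmetry_both two_inner_symmetry_third)

end

theorem proposition4p1:
  fixes cscale :: "complex \<Rightarrow> 'a::ab_group_add \<Rightarrow> 'a"
    and ip :: "'a \<Rightarrow> 'a \<Rightarrow> complex"
    and Fp Fm :: "'a set"
  defines "J \<equiv> fundamental_symmetry Fp Fm"
    and "\<psi> \<equiv> two_inner ip Fp Fm"
    and "N \<equiv> two_norm ip Fp Fm"
  assumes "krein_space cscale ip Fp Fm"
  shows "(\<forall>x y z. \<psi> (J x) y z = \<psi> x (J y) z)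
    \<and> (\<forall>x y z. \<psi> (J x) (J y) z = \<psi> x y z)
    \<and> (\<exists>K::real. K > 0 \<and> (\<forall>x t. N (J x) t + N x (J t) \<le> of_real K * N x t))"
proof -
  interpret krein_space cscale ip Fp Fm by fact
  have "N (J x) t + N x (J t) \<le> of_real 2 * N x t" for x t
    by (simp add: N_def J_def two_norm_symmetry)
  then have "\<exists>K::real. K > 0 \<and> (\<forall>x t. N (J x) t + N x (J t) \<le> of_real K * N x t)"
    by (intro exI[of _ 2]) simp
  then show ?thesis
    unfolding \<psi>_def J_def using two_inner_symmetry_left two_inner_symmetry_both by blast
qed

end
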